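(* For the wheel graph $W_n$ and a vertex $a'$ of $W_n$, $$d_d(a')=\begin{cases}1 & \text{if } a' \text{ is the center vertex},\\ \lceil n/3\rceil & \text{otherwise.}\end{cases}$$
   Context: A dominating set of a finite simple graph $G$ is a set $D\subseteq V(G)$ such that every vertex in $V(G)\setminus D$ is adjacent to some vertex of $D$. A minimal dominating set is a dominating set that does not properly contain any other dominating set. The domination degree of a vertex $a$ is $d_d(a)=\min\{|D| : D \text{ is a minimal dominating set of } G \text{ with } a\in D\}$. The wheel graph $W_n$ is the join of $K_1$ and the cycle $C_n$ on $n$ vertices ($n\ge 3$), i.e. a cycle on $n$ vertices together with one additional vertex (the center vertex, which is the vertex of $K_1$) adjacent to all vertices of the cycle. *)

theory Defs
  imports Complex_Main "Graph_Theory.Kuratowski"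
begin

text \<open>
  A finite simple graph is a digraph satisfying the locale \<^locale>\<open>graph\<close> (respectively
  \<^locale>\<open>pair_graph\<close> when arcs are pairs): an edge \<open>uv\<close> is represented by the two
  arcs \<open>(u, v)\<close> and \<open>(v, u)\<close>.
\<close>

definition dominating_set :: "('a, 'b) pre_digraph \<Rightarrow> 'a set \<Rightarrow> bool" where
  "dominating_set G D \<longleftrightarrow> D \<subseteq> verts G \<and> (\<forall>v \<in> verts G - D. \<exists>u \<in> D. (u, v) \<in> arcs_ends G)"

definition minimal_dominating_set :: "('a, 'b) pre_digraph \<Rightarrow> 'a set \<Rightarrow> bool" where
  "minimal_dominating_set G D \<longleftrightarrow>
     dominating_set G D \<and> \<not> (\<exists>D'. D' \<subset> D \<and> dominating_set G D')"

text \<open>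
  For a vertex \<open>a\<close> of a finite simple graph the minimum is taken over a finite nonempty set,
  since any maximal independent set containing \<open>a\<close> is a minimal dominating set.
\<close>

definition domination_degree :: "('a, 'b) pre_digraph \<Rightarrow> 'a \<Rightarrow> nat" where
  "domination_degree G a = Min {card D | D. minimal_dominating_set G D \<and> a \<in> D}"

definition graph_join ::
    "'a pair_pre_digraph \<Rightarrow> 'b pair_pre_digraph \<Rightarrow> ('a + 'b) pair_pre_digraph" where
  "graph_join G H =
     \<lparr> pverts = pverts G <+> pverts H,
       parcs = {(Inl u, Inl v) | u v. (u, v) \<in> parcs G}
             \<union> {(Inr u, Inr v) | u v. (u, v) \<in> parcs H}
             \<union> {(Inl u, Inr v) | u v. u \<in> pverts G \<and> v \<in> pverts H}
             \<union> {(Inr v, Inl u) | u v. u \<in> pverts G \<and> v \<in> pverts H} \<rparr>"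

definition single_vertex_graph :: "unit pair_pre_digraph" where
  "single_vertex_graph = \<lparr> pverts = {()}, parcs = {} \<rparr>"

definition cycle_graph :: "nat \<Rightarrow> nat pair_pre_digraph" where
  "cycle_graph n =
     \<lparr> pverts = {..<n},
       parcs = {(i, j). i < n \<and> j < n \<and> (j = Suc i mod n \<or> i = Suc j mod n)} \<rparr>"

definition wheel_graph :: "nat \<Rightarrow> (unit + nat) pair_pre_digraph" where
  "wheel_graph n = graph_join single_vertex_graph (cycle_graph n)"

definition wheel_center :: "unit + nat" where
  "wheel_center = Inl ()"

lemma complete_single_vertex_graph: "K\<^bsub>1\<^esub> (with_proj single_vertex_graph)"
  by (auto simp: complete_digraph_pair_def single_vertex_graph_def)

lemma pair_graph_single_vertex_graph: "pair_graph single_vertex_graph"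
  by unfold_locales (auto simp: single_vertex_graph_def symmetric_def sym_def)

lemma pair_graph_cycle_graph:
  assumes "n \<ge> 3"
  shows "pair_graph (cycle_graph n)"
proof -
  have "finite (parcs (cycle_graph n))"
    by (rule finite_subset[of _ "{..<n} \<times> {..<n}"]) (auto simp: cycle_graph_def)
  moreover have "Suc i mod n \<noteq> i" if "i < n" for i
    using that assms by (auto simp: mod_Suc)
  ultimately show ?thesis
    by unfold_locales (force simp: cycle_graph_def symmetric_def sym_def)+
qed

lemma pair_graph_graph_join:
  assumes "pair_graph G" "pair_graph H"
  shows "pair_graph (graph_join G H)"
proof -
  interpret G: pair_graph G by fact
  interpret H: pair_graph H by fact
  have *: "parcs (graph_join G H) \<subseteq> (pverts G <+> pverts H) \<times> (pverts G <+> pverts H)"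
    by (auto simp: graph_join_def dest: G.in_arcsD1 G.in_arcsD2 H.in_arcsD1 H.in_arcsD2)
  have fin: "finite (pverts G <+> pverts H)"
    by (simp add: G.pair_finite_verts H.pair_finite_verts)
  have s: "sym (parcs G)" "sym (parcs H)"
    using G.pair_sym_arcs H.pair_sym_arcs by (simp_all add: symmetric_def)
  have "sym (parcs (graph_join G H))"
    using s by (auto simp: graph_join_def sym_def)
  moreover have "fst e \<noteq> snd e" if "e \<in> parcs (graph_join G H)" for e
    using that by (auto simp: graph_join_def dest: G.pair_no_loops H.pair_no_loops)
  moreover have "finite (parcs (graph_join G H))"
    using * fin by (meson finite_SigmaI finite_subset)
  moreover have "pverts (graph_join G H) = pverts G <+> pverts H"
    by (simp add: graph_join_def)
  ultimately show ?thesis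
    using * fin by unfold_locales (auto simp: symmetric_def)
qed

lemma pair_graph_wheel_graph:
  assumes "n \<ge> 3"
  shows "pair_graph (wheel_graph n)"
  unfolding wheel_graph_def
  using assms pair_graph_single_vertex_graph pair_graph_cycle_graph pair_graph_graph_join by blast

end

theory Submission
  imports Defs
begin

text \<open>
  The center dominates the whole wheel, so the only minimal dominating set containing the center
  is the singleton of the center, and the center has domination degree 1.  Every other minimal
  dominating set therefore lies on the rim, and a set of rim vertices dominates the wheel exactly
  when it is nonempty and dominates the cycle (lemma \<open>dominating_set_cone_rim_iff\<close>).

  A vertex of the cycle dominates only itself and its two neighbours, so a dominating set \<open>D\<close> of
  \<open>C\<^sub>n\<close> has \<open>n \<le> 3 |D|\<close>.  Taking every third vertex, starting from a prescribed vertex \<open>a\<close>,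
  attains \<open>\<lceil>n/3\<rceil>\<close>.  That set has the least size possible for a dominating set of the cycle, and
  this already makes it minimal in the wheel: a proper subset that dominates the wheel would be a
  smaller dominating set of the cycle.
\<close>

section \<open>Computing a domination degree\<close>

lemma domination_degree_eqI:
  assumes "finite (verts G)" "minimal_dominating_set G D" "a \<in> D"
    and "\<And>D'. minimal_dominating_set G D' \<Longrightarrow> a \<in> D' \<Longrightarrow> card D \<le> card D'"
  shows "domination_degree G a = card D"
  unfolding domination_degree_def
proof (rule Min_eqI)
  have "{card D' |D'. minimal_dominating_set G D' \<and> a \<in> D'} \<subseteq> card ` Pow (verts G)"
    by (auto simp: minimal_dominating_set_def dominating_set_def)
  then show "finite {card D' |D'. minimal_dominating_set G D' \<and> a \<in> D'}"
    using assms(1) by (meson finite_Pow_iff finite_imageI finite_subset)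
qed (use assms in auto)

section \<open>Dominating sets of the cone over a graph\<close>

lemma dominating_set_cone_apex:
  "dominating_set (with_proj (graph_join single_vertex_graph H)) {Inl ()}"
  by (auto simp: dominating_set_def graph_join_def single_vertex_graph_def)

lemma minimal_dominating_set_cone_apex:
  "minimal_dominating_set (with_proj (graph_join single_vertex_graph H)) {Inl ()}"
proof -
  have "\<not> dominating_set (with_proj (graph_join single_vertex_graph H)) {}"
    by (auto simp: dominating_set_def graph_join_def single_vertex_graph_def)
  then show ?thesis
    using dominating_set_cone_apex by (auto simp: minimal_dominating_set_def psubset_eq subset_singleton_iff)
qed

lemma minimal_dominating_set_cone_with_apex:
  assumes "minimal_dominating_set (with_proj (graph_join single_vertex_graph H)) D" "Inl () \<in> D"
  shows "D = {Inl ()}"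
  using assms dominating_set_cone_apex[of H] unfolding minimal_dominating_set_def
  by (metis empty_subsetI insert_subset psubsetI)

text \<open>Nonemptiness is what it takes to dominate the apex.\<close>

lemma dominating_set_cone_rim_iff:
  "dominating_set (with_proj (graph_join single_vertex_graph H)) (Inr ` D) \<longleftrightarrow>
     D \<noteq> {} \<and> dominating_set (with_proj H) D"
  unfolding dominating_set_def graph_join_def single_vertex_graph_def
  by (auto simp: Plus_def; blast)

lemma rim_set_eq_image:
  fixes D :: "(unit + 'a) set"
  assumes "Inl () \<notin> D"
  obtains D' where "D = Inr ` D'"
proof
  show "D = Inr ` (Inr -` D)"
  proof (intro equalityI subsetI)
    fix x assume "x \<in> D"
    with assms show "x \<in> Inr ` (Inr -` D)" by (cases x) auto
  qed auto
qed

lemma minimal_dominating_set_cone_rim: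
  assumes "dominating_set (with_proj H) D" "D \<noteq> {}" "finite D"
    and least: "\<And>D'. dominating_set (with_proj H) D' \<Longrightarrow> card D \<le> card D'"
  shows "minimal_dominating_set (with_proj (graph_join single_vertex_graph H)) (Inr ` D)"
  unfolding minimal_dominating_set_def
proof (intro conjI notI)
  show "dominating_set (with_proj (graph_join single_vertex_graph H)) (Inr ` D)"
    using assms by (simp add: dominating_set_cone_rim_iff)
next
  assume "\<exists>E. E \<subset> Inr ` D \<and> dominating_set (with_proj (graph_join single_vertex_graph H)) E"
  then obtain E where E: "E \<subset> Inr ` D"
      "dominating_set (with_proj (graph_join single_vertex_graph H)) E" by blast
  then have "Inl () \<notin> E" by auto
  then obtain E' where E': "E = Inr ` E'" by (rule rim_set_eq_image)
  with E have "E' \<subset> D" by auto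
  then have "card E' < card D" using \<open>finite D\<close> by (rule psubset_card_mono[rotated])
  moreover have "dominating_set (with_proj H) E'"
    using E E' by (simp add: dominating_set_cone_rim_iff)
  ultimately show False using least by fastforce
qed

text \<open>
  A minimum dominating set of the base through \<open>a\<close> realises the domination degree of \<open>a\<close> in the
  cone, since a minimal dominating set through \<open>a\<close> cannot contain the apex.
\<close>

lemma domination_degree_cone_rim:
  assumes "finite (pverts H)" "dominating_set (with_proj H) D" "a \<in> D"
    and least: "\<And>D'. dominating_set (with_proj H) D' \<Longrightarrow> card D \<le> card D'"
  shows "domination_degree (with_proj (graph_join single_vertex_graph H)) (Inr a) = card D"
proof -
  let ?G = "with_proj (graph_join single_vertex_graph H)"
  have "finite D"
    using assms(1,2) by (auto simp: dominating_set_def intro: finite_subset)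
  have card_rim: "card (Inr ` E :: (unit + 'a) set) = card E" for E :: "'a set"
    by (simp add: card_image)
  have "domination_degree ?G (Inr a) = card (Inr ` D :: (unit + 'a) set)"
  proof (rule domination_degree_eqI)
    show "finite (verts ?G)"
      using assms(1) by (simp add: graph_join_def single_vertex_graph_def)
    show "minimal_dominating_set ?G (Inr ` D)"
      using assms \<open>finite D\<close> by (intro minimal_dominating_set_cone_rim) auto
    show "Inr a \<in> Inr ` D" using assms(3) by blast
  next
    fix E assume E: "minimal_dominating_set ?G E" "Inr a \<in> E"
    then have "Inl () \<notin> E" using minimal_dominating_set_cone_with_apex by fastforce
    then obtain E' where E': "E = Inr ` E'" by (rule rim_set_eq_image)
    with E have "dominating_set (with_proj H) E'"
      by (simp add: minimal_dominating_set_def dominating_set_cone_rim_iff)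
    then show "card (Inr ` D :: (unit + 'a) set) \<le> card E"
      using least E' by (simp add: card_rim)
  qed
  then show ?thesis by (simp add: card_rim)
qed

section \<open>Dominating sets of the cycle\<close>

text \<open>Closed neighbourhoods in a cycle have at most three elements, and those of \<open>D\<close> cover it.\<close>

lemma cycle_dominating_set_card_ge:
  assumes "dominating_set (with_proj (cycle_graph n)) D"
  shows "n \<le> 3 * card D"
proof -
  have sub: "D \<subseteq> {..<n}" and
    dom: "\<And>v. v < n \<Longrightarrow> v \<notin> D \<Longrightarrow> \<exists>u\<in>D. v = Suc u mod n \<or> u = Suc v mod n"
    using assms by (auto simp: dominating_set_def cycle_graph_def)
  have fin: "finite D" using sub by (rule finite_subset) simp
  have pred: "v = (Suc v mod n + n - 1) mod n" if "v < n" for v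
    using that by (auto simp: mod_Suc)
  let ?N = "\<lambda>u. {u, Suc u mod n, (u + n - 1) mod n}"
  have "{..<n} \<subseteq> (\<Union>u\<in>D. ?N u)"
    using dom pred by fastforce
  then have "card {..<n} \<le> card (\<Union>u\<in>D. ?N u)"
    using fin by (intro card_mono) auto
  also have "\<dots> \<le> (\<Sum>u\<in>D. card (?N u))"
    using fin by (rule card_UN_le)
  also have "\<dots> \<le> (\<Sum>u\<in>D. 3)"
    by (intro sum_mono) (simp add: card_insert_if)
  finally show ?thesis by simp
qed

definition every_third :: "nat \<Rightarrow> nat \<Rightarrow> nat set" where
  "every_third n a = (\<lambda>k. (a + 3 * k) mod n) ` {..<(n + 2) div 3}"

lemma every_third_dominates_cycle:
  assumes "a < n"
  shows "dominating_set (with_proj (cycle_graph n)) (every_third n a)"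
proof -
  have mem: "(a + 3 * k) mod n \<in> every_third n a" if "3 * k < n" for k
    unfolding every_third_def using that by (intro imageI) auto
  have succ: "Suc ((a + t) mod n) mod n = (a + Suc t) mod n" for t
    by (simp add: mod_Suc_eq)
  have "\<exists>u\<in>every_third n a. v = Suc u mod n \<or> u = Suc v mod n"
    if v: "v < n" "v \<notin> every_third n a" for v
  proof -
    \<comment> \<open>\<open>t\<close> is the distance from \<open>a\<close> to \<open>v\<close> along the cycle.\<close>
    define t where "t = (v + n - a) mod n"
    have t: "t < n" "v = (a + t) mod n"
      using assms v by (simp_all add: t_def mod_add_right_eq)
    define k where "k = t div 3"
    have "t = 3 * k \<or> t = Suc (3 * k) \<or> t = 3 * k + 2"
      unfolding k_def by presburger
    then consider "t = 3 * k" | "t = Suc (3 * k)" | "t = 3 * k + 2" by blast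
    then show ?thesis
    proof cases
      case 1
      with v t mem show ?thesis by auto
    next
      case 2
      with t succ[of "3 * k"] have "v = Suc ((a + 3 * k) mod n) mod n" "3 * k < n" by simp_all
      with mem show ?thesis by blast
    next
      case 3
      show ?thesis
      proof (cases "Suc t < n")
        case True
        with 3 t mem[of "Suc k"] succ[of t] show ?thesis
          by (auto simp: numeral_3_eq_3)
      next
        \<comment> \<open>The last group of three is cut short, and \<open>v\<close> is the vertex just before \<open>a\<close>.\<close>
        case False
        with t have "Suc t = n" by simp
        with succ[of t] assms t have "Suc v mod n = a" by simp
        with mem[of 0] assms show ?thesis by auto
      qed
    qed
  qed
  moreover have "every_third n a \<subseteq> {..<n}"
    using assms by (auto simp: every_third_def)
  ultimately show ?thesis
    by (fastforce simp: dominating_set_def cycle_graph_def)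
qed

text \<open>The listed vertices are distinct because a dominating set cannot have fewer elements.\<close>

lemma card_every_third:
  assumes "a < n"
  shows "card (every_third n a) = (n + 2) div 3"
proof (rule antisym)
  show "card (every_third n a) \<le> (n + 2) div 3"
    unfolding every_third_def by (metis card_image_le card_lessThan finite_lessThan)
  show "(n + 2) div 3 \<le> card (every_third n a)"
    using cycle_dominating_set_card_ge[OF every_third_dominates_cycle[OF assms]] by linarith
qed

section \<open>The domination degree in the wheel\<close>

lemma domination_degree_wheel_center:
  "domination_degree (with_proj (wheel_graph n)) wheel_center = 1"
proof -
  have "domination_degree (with_proj (wheel_graph n)) wheel_center = card {wheel_center}"
    unfolding wheel_graph_def wheel_center_def
  proof (rule domination_degree_eqI[OF _ minimal_dominating_set_cone_apex])
    show "finite (verts (with_proj (graph_join single_vertex_graph (cycle_graph n))))"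
      by (simp add: graph_join_def single_vertex_graph_def cycle_graph_def)
  qed (use minimal_dominating_set_cone_with_apex in fastforce)+
  then show ?thesis by simp
qed

lemma domination_degree_wheel_rim:
  assumes "a < n"
  shows "domination_degree (with_proj (wheel_graph n)) (Inr a) = (n + 2) div 3"
proof -
  have "domination_degree (with_proj (wheel_graph n)) (Inr a) = card (every_third n a)"
    unfolding wheel_graph_def
  proof (rule domination_degree_cone_rim[OF _ every_third_dominates_cycle[OF assms]])
    show "finite (pverts (cycle_graph n))" by (simp add: cycle_graph_def)
    show "a \<in> every_third n a"
      using assms unfolding every_third_def by (intro image_eqI[of _ _ 0]) auto
    show "card (every_third n a) \<le> card D"
      if "dominating_set (with_proj (cycle_graph n)) D" for D
      using cycle_dominating_set_card_ge[OF that] card_every_third[OF assms] by linarith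
  qed
  then show ?thesis by (simp add: card_every_third[OF assms])
qed

theorem proposition3p16:
  fixes n :: nat and a' :: "unit + nat"
  assumes "n \<ge> 3"
    and "a' \<in> pverts (wheel_graph n)"
  shows "int (domination_degree (with_proj (wheel_graph n)) a') =
    (if a' = wheel_center then 1 else \<lceil>real n / 3\<rceil>)"
proof (cases "a' = wheel_center")
  case True
  then show ?thesis by (simp add: domination_degree_wheel_center)
next
  case False
  with assms(2) obtain a where a: "a' = Inr a" "a < n"
    by (auto simp: wheel_graph_def graph_join_def single_vertex_graph_def cycle_graph_def
        wheel_center_def)
  have "\<lceil>real n / 3\<rceil> = int ((n + 2) div 3)"
    by (rule ceiling_unique) linarith+
  with False a show ?thesis by (simp add: domination_degree_wheel_rim)
qed

end
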